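(* Let $\mathbf{c}\in\mathbb{F}_{q^2}^4$ with $\mathbf{c}\neq0$. If $g_{\mathbf{c}}$ is non-constant and $A_{\mathbf{c}}(X)$ has no roots in $\mu_{q+1}$, then $f_{\mathbf{c}}$ is linear equivalent to one of the following functions: \begin{enumerate} \item $P_0(x,y)=(x^{Q+1},y^{Q+1}):\mathbb{F}_q^2\to\mathbb{F}_q^2$; \item $f_0(X)=X^{Q+1}$ on $\mathbb{F}_{q^2}$; \item $f_1(X)=X^{Q+q}$ on $\mathbb{F}_{q^2}$; \item $P_1(x,y)=(x^{Q+1},xy^Q+y^{Q+1}):\mathbb{F}_q^2\to\mathbb{F}_q^2$; \item $P_2(x,y)=(x^Qy,x^{Q+1}+\varepsilon y^{Q+1}):\mathbb{F}_q^2\to\mathbb{F}_q^2$ for some $\varepsilon\in\mathbb{F}_q^*$; \item $P_3(x,y)=(x^{Q+1}-x^Qy,xy^Q+\varepsilon y^{Q+1}):\mathbb{F}_q^2\to\mathbb{F}_q^2$ for some $\varepsilon\in\mathbb{F}_q^*\setminus\{-1\}$; \item $f_2(X)=X^{Q+q}+\varepsilon X^{Q+1}$ on $\mathbb{F}_{q^2}$ for some $\varepsilon\in\mathbb{F}_{q^2}^*\setminus\mu_{q+1}$. \end{enumerate}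
   Context: Let $p$ be an odd prime, $k,\ell$ positive integers, $q=p^k$, $Q=p^\ell$; for $c\in\mathbb{F}_{q^2}$ write $\bar c=c^q$; $\mu_{q+1}$ is the set of $(q+1)$-th roots of unity in $\overline{\mathbb{F}}_q$. For $\mathbf{c}=(c_0,c_1,c_2,c_3)\in\mathbb{F}_{q^2}^4$ define $f_{\mathbf{c}}(X)=c_0X^{qQ+q}+c_1X^{qQ+1}+c_2X^{Q+q}+c_3X^{Q+1}$, $A_{\mathbf{c}}(X)=c_0X^{Q+1}+c_1X^Q+c_2X+c_3$, $B_{\mathbf{c}}(X)=\bar c_3X^{Q+1}+\bar c_2X^Q+\bar c_1X+\bar c_0$, and (for $\mathbf{c}\ne0$) the rational function $g_{\mathbf{c}}=B_{\mathbf{c}}/A_{\mathbf{c}}$. Two maps $F:V\to V$, $F':V'\to V'$ with $V,V'\in\{\mathbb{F}_{q^2},\mathbb{F}_q^2\}$ are linear equivalent if $F'=L_1\circ F\circ L_2$ for some $\mathbb{F}_p$-linear bijections $L_2:V'\to V$, $L_1:V\to V'$. *)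

theory Defs
  imports
    "HOL-Library.Product_Plus"
    "HOL-Library.Cardinality"
    "HOL-Computational_Algebra.Computational_Algebra"
    "HOL-Algebra.Algebraic_Closure_Type"
begin

(* The field F_{q^2} is a type 'a :: {field, finite} with CARD('a) = q^2.  Its subfields F_q and
   F_p are the fixed sets of the corresponding Frobenius maps, and F_q^2 is the subset F_q x F_q
   of the type 'a \<times> 'a. *)

definition subfield_of_order :: "nat \<Rightarrow> 'a::field set" where
  "subfield_of_order r = {x. x ^ r = x}"

definition roots_of_unity :: "nat \<Rightarrow> 'b::field set" where
  "roots_of_unity n = {z. z ^ n = 1}"

definition pair_scale :: "'a::field \<Rightarrow> 'a \<times> 'a \<Rightarrow> 'a \<times> 'a" where
  "pair_scale r v = (r * fst v, r * snd v)"

fun f_fun :: "nat \<Rightarrow> nat \<Rightarrow> 'a \<times> 'a \<times> 'a \<times> 'a \<Rightarrow> 'a \<Rightarrow> 'a::field" where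
  "f_fun q Q (c0, c1, c2, c3) x =
     c0 * x ^ (q * Q + q) + c1 * x ^ (q * Q + 1) + c2 * x ^ (Q + q) + c3 * x ^ (Q + 1)"

fun A_poly :: "nat \<Rightarrow> 'a \<times> 'a \<times> 'a \<times> 'a \<Rightarrow> 'a::field poly" where
  "A_poly Q (c0, c1, c2, c3) =
     Polynomial.monom c0 (Q + 1) + Polynomial.monom c1 Q + Polynomial.monom c2 1
       + Polynomial.monom c3 0"

fun B_poly :: "nat \<Rightarrow> nat \<Rightarrow> 'a \<times> 'a \<times> 'a \<times> 'a \<Rightarrow> 'a::field poly" where
  "B_poly q Q (c0, c1, c2, c3) =
     Polynomial.monom (c3 ^ q) (Q + 1) + Polynomial.monom (c2 ^ q) Q
       + Polynomial.monom (c1 ^ q) 1 + Polynomial.monom (c0 ^ q) 0"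

(* An element of the field of rational functions.  For Q > 1 and c \<noteq> 0 the denominator is a
   nonzero polynomial. *)
definition g_fract :: "nat \<Rightarrow> nat \<Rightarrow> 'a \<times> 'a \<times> 'a \<times> 'a \<Rightarrow> 'a::field poly fract" where
  "g_fract q Q c = Fract (B_poly q Q c) (A_poly Q c)"

definition constant_fract :: "'a::field poly fract \<Rightarrow> bool" where
  "constant_fract g \<longleftrightarrow> (\<exists>a. g = Fract [:a:] 1)"

(* K is the set of scalars; s and s' are the scalar multiplications on V and W. *)
definition linear_bij ::
  "'k set \<Rightarrow> ('k \<Rightarrow> 'v \<Rightarrow> 'v) \<Rightarrow> 'v set \<Rightarrow> ('k \<Rightarrow> 'w \<Rightarrow> 'w) \<Rightarrow> 'w set \<Rightarrow> ('v::plus \<Rightarrow> 'w::plus) \<Rightarrow> bool"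
  where
  "linear_bij K s V s' W L \<longleftrightarrow>
     bij_betw L V W \<and>
     (\<forall>x\<in>V. \<forall>y\<in>V. L (x + y) = L x + L y) \<and>
     (\<forall>r\<in>K. \<forall>x\<in>V. L (s r x) = s' r (L x))"

definition linear_equivalent ::
  "'k set \<Rightarrow> ('k \<Rightarrow> 'v \<Rightarrow> 'v) \<Rightarrow> 'v set \<Rightarrow> ('v::plus \<Rightarrow> 'v)
     \<Rightarrow> ('k \<Rightarrow> 'w \<Rightarrow> 'w) \<Rightarrow> 'w set \<Rightarrow> ('w::plus \<Rightarrow> 'w) \<Rightarrow> bool"
  where
  "linear_equivalent K s V F s' V' F' \<longleftrightarrow>
     (\<exists>L1 L2. linear_bij K s' V' s V L2 \<and> linear_bij K s V s' V' L1 \<and>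
        (\<forall>x\<in>V'. F' x = L1 (F (L2 x))))"

(* Equivalence of a map on F_{q^2} with a map on F_{q^2}, respectively with a map on F_q^2. *)

definition lin_equiv_field :: "nat \<Rightarrow> ('a::field \<Rightarrow> 'a) \<Rightarrow> ('a \<Rightarrow> 'a) \<Rightarrow> bool" where
  "lin_equiv_field p F F' \<longleftrightarrow>
     linear_equivalent (subfield_of_order p) (*) UNIV F (*) UNIV F'"

definition lin_equiv_plane ::
  "nat \<Rightarrow> nat \<Rightarrow> ('a::field \<Rightarrow> 'a) \<Rightarrow> ('a \<times> 'a \<Rightarrow> 'a \<times> 'a) \<Rightarrow> bool" where
  "lin_equiv_plane p q F F' \<longleftrightarrow>
     linear_equivalent (subfield_of_order p) (*) UNIV F
       pair_scale (subfield_of_order q \<times> subfield_of_order q) F'"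

end

theory Submission
  imports Defs "HOL-Number_Theory.Residues"
begin

text \<open>
  Write \<open>cnj x = x\<^sup>q\<close>. The \<open>\<F>\<^sub>q\<close>-valued forms \<open>tr \<theta> (f x) = \<theta> (f x) + (cnj \<theta>) cnj (f x)\<close>, or after extension of scalars
  the forms \<open>s f + t (cnj \<circ> f)\<close>, make up a pencil of 2 \<open>\<times>\<close> 2 matrices, acting by
  \<open>(x\<^sup>Q, (cnj x)\<^sup>Q)\<close> on the left and \<open>(x, cnj x)\<close> on the right. The pencil has dimension two because \<open>g\<close> is
  nonconstant, and \<open>f\<close> has no nontrivial zero because \<open>A\<close> has no root in \<open>\<mu>\<^bsub>q+1\<^esub>\<close>. Its determinant is a
  binary quadratic form whose discriminant lies in \<open>\<F>\<^sub>q\<close>, so the pencil has a singular member \<open>s f + t (cnj \<circ> f)\<close>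
  over \<open>\<F>\<^bsub>q^2\<^esub>\<close>, and this member is a product \<open>u(x)\<^sup>Q v(x)\<close> of linear forms. If \<open>[s : t]\<close> is not
  defined over \<open>\<F>\<^sub>q\<close>, then \<open>u\<close> and \<open>v\<close> are bijective and \<open>f\<close> is equivalent to \<open>f\<^sub>0\<close>, \<open>f\<^sub>1\<close> or \<open>f\<^sub>2\<close>. Otherwise
  \<open>u\<close> and \<open>v\<close> can be taken \<open>\<F>\<^sub>q\<close>-valued. Two such members give \<open>P\<^sub>0\<close>, \<open>P\<^sub>1\<close> or \<open>P\<^sub>3\<close>, according to which of
  the linear forms are proportional; a single one gives \<open>P\<^sub>2\<close>.
\<close>

section \<open>Linear bijections and equivalences read from the field outwards\<close>

lemma linear_bij_inv:
  fixes L :: "'v::plus \<Rightarrow> 'w::plus"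
  assumes L: "linear_bij K s UNIV s' W L"
  shows "linear_bij K s' W s UNIV (inv_into UNIV L)"
proof -
  have bij: "bij_betw L UNIV W"
    using L by (simp add: linear_bij_def)
  hence inj: "inj L" and right: "\<And>w. w \<in> W \<Longrightarrow> L (inv_into UNIV L w) = w"
    by (auto simp: bij_betw_def f_inv_into_f)
  have "inv_into UNIV L (x + y) = inv_into UNIV L x + inv_into UNIV L y" if "x \<in> W" "y \<in> W" for x y
    by (rule inv_f_eq[OF inj]) (use L that in \<open>simp add: linear_bij_def right\<close>)
  moreover have "inv_into UNIV L (s' r x) = s r (inv_into UNIV L x)" if "r \<in> K" "x \<in> W" for r x
    by (rule inv_f_eq[OF inj]) (use L that in \<open>simp add: linear_bij_def right\<close>)
  ultimately show ?thesis
    using bij by (simp add: linear_bij_def bij_betw_inv_into)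
qed

text \<open>The definition asks for a substitution into the field, but explicit linear forms map out
  of it. So \<open>N\<close> is given in the forward direction and its inverse serves as
  \<open>L2\<close>.\<close>

lemma linear_equivalentI:
  fixes L N :: "'v::plus \<Rightarrow> 'w::plus"
  assumes L: "linear_bij K s UNIV s' W L" and N: "linear_bij K s UNIV s' W N"
    and eq: "\<And>x. F' (N x) = L (F x)"
  shows "linear_equivalent K s UNIV F s' W F'"
  unfolding linear_equivalent_def
proof (intro exI conjI ballI)
  show "linear_bij K s' W s UNIV (inv_into UNIV N)"
    by (rule linear_bij_inv[OF N])
  show "linear_bij K s UNIV s' W L" by fact
  fix w assume "w \<in> W"
  with N have "N (inv_into UNIV N w) = w"
    by (auto simp: linear_bij_def bij_betw_def f_inv_into_f)
  thus "F' w = L (F (inv_into UNIV N w))"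
    using eq[of "inv_into UNIV N w"] by simp
qed

section \<open>Fields with an involution\<close>

text \<open>The involution \<open>cnj\<close> abstracts \<open>x \<mapsto> x\<^sup>q\<close>, whose fixed field is \<open>\<F>\<^sub>q\<close>, and \<open>fr\<close> abstracts
  \<open>x \<mapsto> x\<^sup>Q\<close>; \<open>K\<close> stands for \<open>\<F>\<^sub>p\<close>.\<close>

locale conj_field =
  fixes cnj fr :: "'a::{field,finite} \<Rightarrow> 'a" and K :: "'a set"
  assumes cnj_add [simp]: "cnj (x + y) = cnj x + cnj y"
    and cnj_mult [simp]: "cnj (x * y) = cnj x * cnj y"
    and cnj_cnj [simp]: "cnj (cnj x) = x"
    and cnj_nontrivial: "\<exists>x. cnj x \<noteq> x"
    and fr_add [simp]: "fr (x + y) = fr x + fr y"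
    and fr_mult [simp]: "fr (x * y) = fr x * fr y"
    and fr_1 [simp]: "fr 1 = 1"
    and cnj_fr [simp]: "cnj (fr x) = fr (cnj x)"
    and real_square: "cnj a = a \<Longrightarrow> \<exists>d. d ^ 2 = a"
    and char_not_2: "(2::'a) \<noteq> 0"
    and K_real: "r \<in> K \<Longrightarrow> cnj r = r"
begin

lemma cnj_0 [simp]: "cnj 0 = 0"
  by (rule add_left_imp_eq[of "cnj 0"]) (simp flip: cnj_add)

lemma cnj_eq_0_iff [simp]: "cnj x = 0 \<longleftrightarrow> x = 0"
  by (metis cnj_0 cnj_cnj)

lemma cnj_1 [simp]: "cnj 1 = 1"
  using cnj_mult[of "cnj 1" 1] by simp

lemma cnj_minus [simp]: "cnj (- x) = - cnj x"
  using cnj_add[of x "- x"] by (simp add: eq_neg_iff_add_eq_0 add.commute)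

lemma cnj_diff [simp]: "cnj (x - y) = cnj x - cnj y"
  using cnj_add[of x "- y"] by simp

lemma cnj_divide [simp]: "cnj (x / y) = cnj x / cnj y"
proof (cases "y = 0")
  case False
  thus ?thesis using cnj_mult[of "x / y" y] by (simp add: field_simps)
qed simp

lemma fr_0 [simp]: "fr 0 = 0"
  by (rule add_left_imp_eq[of "fr 0"]) (simp flip: fr_add)

lemma fr_minus [simp]: "fr (- x) = - fr x"
  using fr_add[of x "- x"] by (simp add: eq_neg_iff_add_eq_0 add.commute)

lemma fr_diff [simp]: "fr (x - y) = fr x - fr y"
  using fr_add[of x "- y"] by simp

lemma fr_eq_0_iff [simp]: "fr x = 0 \<longleftrightarrow> x = 0"
proof
  assume "fr x = 0"
  thus "x = 0" using fr_mult[of x "1 / x"] by (cases "x = 0") auto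
qed simp

lemma fr_divide [simp]: "fr (x / y) = fr x / fr y"
proof (cases "y = 0")
  case False
  thus ?thesis using fr_mult[of "x / y" y] by (simp add: field_simps)
qed simp

lemma fr_surj: "\<exists>y. fr y = x"
proof -
  have "inj fr"
  proof (rule injI)
    fix x y assume "fr x = fr y"
    hence "fr (x - y) = 0" by simp
    thus "x = y" by (simp only: fr_eq_0_iff) simp
  qed
  hence "surj fr" by (simp add: finite_UNIV_inj_surj)
  thus ?thesis by (metis surjD)
qed

text \<open>\<open>fr\<close> is injective and commutes with \<open>cnj\<close>, so a root of a
  fixed element is itself fixed.\<close>

lemma fr_real_root:
  assumes "cnj x = x"
  obtains y where "fr y = x" "cnj y = y"
proof -
  obtain y where y: "fr y = x" using fr_surj by blast
  hence "fr (cnj y - y) = 0" using assms cnj_fr[of y] by simp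
  hence "cnj y = y" by (simp only: fr_eq_0_iff) simp
  with y that show ?thesis by blast
qed

section \<open>Trace forms to the fixed field and their determinants\<close>

definition tr :: "'a \<Rightarrow> 'a \<Rightarrow> 'a" where
  "tr a x = a * x + cnj a * cnj x"

text \<open>Determinant of the coefficient vectors of \<open>tr a\<close> and \<open>tr b\<close>.
  It vanishes exactly when \<open>a\<close> and \<open>b\<close> are dependent over the fixed
  field.\<close>

definition dt :: "'a \<Rightarrow> 'a \<Rightarrow> 'a" where
  "dt a b = a * cnj b - cnj a * b"

definition reals :: "'a set" where
  "reals = {x. cnj x = x}"

lemma cnj_tr [simp]: "cnj (tr a x) = tr a x"
  by (simp add: tr_def)

lemma tr_add_right: "tr a (x + y) = tr a x + tr a y"
  by (simp add: tr_def algebra_simps)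

lemma tr_add_left: "tr (a + b) x = tr a x + tr b x"
  by (simp add: tr_def algebra_simps)

lemma tr_real_left: "cnj r = r \<Longrightarrow> tr (r * a) x = r * tr a x"
  by (simp add: tr_def algebra_simps)

lemma tr_real_right: "cnj r = r \<Longrightarrow> tr a (r * x) = r * tr a x"
  by (simp add: tr_def algebra_simps)

lemma tr_0_right [simp]: "tr a 0 = 0"
  by (simp add: tr_def)

lemma cnj_dt: "cnj (dt a b) = - dt a b"
  by (simp add: dt_def)

lemma dt_swap: "dt b a = - dt a b"
  by (simp add: dt_def algebra_simps)

text \<open>Cramer's rule. Because \<open>dt a b\<close> changes sign under \<open>cnj\<close>, the
  vectors \<open>cnj b / dt a b\<close> and \<open>- cnj a / dt a b\<close> are dual to the two
  trace forms.\<close>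

lemma dual_basis:
  assumes "dt a b \<noteq> 0"
  obtains u v where "tr a u = 1" "tr b u = 0" "tr a v = 0" "tr b v = 1"
    "\<And>x. x = tr a x * u + tr b x * v"
proof
  let ?d = "dt a b"
  have d: "cnj ?d = - ?d" by (rule cnj_dt)
  show "tr a (cnj b / ?d) = 1" "tr b (cnj b / ?d) = 0" "tr a (- cnj a / ?d) = 0" "tr b (- cnj a / ?d) = 1"
    using assms by (simp_all add: tr_def d divide_simps) (simp_all add: dt_def algebra_simps)
  show "x = tr a x * (cnj b / ?d) + tr b x * (- cnj a / ?d)" for x
    using assms by (simp add: divide_simps) (simp add: dt_def tr_def algebra_simps)
qed

lemma tr_pair_bij:
  assumes "dt a b \<noteq> 0"
  shows "linear_bij K (*) UNIV pair_scale (reals \<times> reals) (\<lambda>x. (tr a x, tr b x))"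
proof -
  obtain u v where uv: "tr a u = 1" "tr b u = 0" "tr a v = 0" "tr b v = 1"
    and x: "\<And>x. x = tr a x * u + tr b x * v"
    using dual_basis[OF assms] by blast
  have "inj (\<lambda>x. (tr a x, tr b x))"
    by (rule injI) (metis x prod.inject)
  moreover have "(y, z) \<in> range (\<lambda>x. (tr a x, tr b x))" if "cnj y = y" "cnj z = z" for y z
  proof (rule range_eqI)
    show "(y, z) = (tr a (y * u + z * v), tr b (y * u + z * v))"
      by (simp add: tr_add_right tr_real_right that uv)
  qed
  ultimately show ?thesis
    by (auto simp: linear_bij_def bij_betw_def pair_scale_def reals_def tr_add_right
        tr_real_right K_real)
qed

lemma dt_nonzero_ex:
  assumes "a \<noteq> 0"
  obtains b where "dt a b \<noteq> 0"
proof -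
  obtain w where "cnj w \<noteq> w" using cnj_nontrivial by blast
  hence "dt a (w * a) \<noteq> 0" using assms
    by (simp add: dt_def algebra_simps)
  thus ?thesis by (rule that)
qed

text \<open>Hilbert 90 for a quadratic extension: a ratio \<open>s / t\<close> of norm one equals
  \<open>b / cnj b\<close>. Every resolvent \<open>B w\<close> satisfies the equation, and they
  cannot all vanish.\<close>

lemma hilbert90:
  assumes "s * cnj s = t * cnj t" "s \<noteq> 0 \<or> t \<noteq> 0"
  obtains b where "b \<noteq> 0" "b * t = s * cnj b"
proof -
  define B where "B w = s * w + cnj t * cnj w" for w
  have B: "B w * t = s * cnj (B w)" for w
  proof -
    have "B w * t = s * t * w + (t * cnj t) * cnj w" by (simp add: B_def algebra_simps)
    also have "\<dots> = s * t * w + (s * cnj s) * cnj w" by (simp only: assms(1))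
    also have "\<dots> = s * cnj (B w)" by (simp add: B_def algebra_simps)
    finally show ?thesis .
  qed
  have "\<exists>w. B w \<noteq> 0"
  proof (rule ccontr)
    assume "\<nexists>w. B w \<noteq> 0"
    hence 0: "B w = 0" for w by blast
    obtain w where w: "cnj w \<noteq> w" using cnj_nontrivial by blast
    have t: "cnj t = - s" using 0[of 1] by (simp add: B_def add_eq_0_iff)
    have "s * (w - cnj w) = 0" using 0[of w] by (simp add: B_def t algebra_simps)
    hence "s = 0" using w by simp
    with t assms(2) show False by simp
  qed
  with B that show ?thesis by blast
qed

text \<open>If the norms agreed, Hilbert 90 would supply a nonzero kernel vector.\<close>

lemma norm_neq_of_inj:
  assumes "\<And>x. a * x + b * cnj x = 0 \<Longrightarrow> x = 0"
  shows "a * cnj a \<noteq> b * cnj b"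
proof
  assume eq: "a * cnj a = b * cnj b"
  have "a \<noteq> 0" using assms[of 1] eq by auto
  have "b * cnj b = (- a) * cnj (- a)" "b \<noteq> 0 \<or> - a \<noteq> 0"
    using eq \<open>a \<noteq> 0\<close> by simp_all
  then obtain y where y: "y \<noteq> 0" "y * - a = b * cnj y"
    by (rule hilbert90)
  have "a * y + b * cnj y = a * y + y * - a" by (simp only: y(2))
  hence "a * y + b * cnj y = 0" by simp
  thus False using assms y(1) by blast
qed

lemma conj_linear_kernel:
  assumes "a * cnj a \<noteq> b * cnj b" "a * x + b * cnj x = 0"
  shows "x = 0"
proof -
  have "(a * cnj a - b * cnj b) * x = cnj a * (a * x + b * cnj x) - b * cnj (a * x + b * cnj x)"
    by (simp add: algebra_simps)
  also have "\<dots> = 0" unfolding assms(2) by simp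
  finally show ?thesis using assms(1) by simp
qed

lemma field_bij:
  assumes "a * cnj a \<noteq> b * cnj b"
  shows "linear_bij K (*) UNIV (*) UNIV (\<lambda>x. a * x + b * cnj x)"
proof -
  let ?L = "\<lambda>x. a * x + b * cnj x"
  have "inj ?L"
  proof (rule injI)
    fix x y assume "?L x = ?L y"
    hence "?L (x - y) = 0" by (simp add: algebra_simps)
    hence "x - y = 0" by (rule conj_linear_kernel[OF assms])
    thus "x = y" by simp
  qed
  hence "bij ?L" by (simp add: bij_def finite_UNIV_inj_surj)
  thus ?thesis
    by (auto simp: linear_bij_def algebra_simps K_real)
qed

text \<open>A singular matrix is a column times a row. The column entries are written as values of
  \<open>fr\<close>, which is surjective, so the form becomes
  \<open>fr (a * x + b * cnj x) * (g * x + d * cnj x)\<close>.\<close>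

lemma rank_one:
  assumes "m0 * m3 = m1 * m2"
  obtains a b g d where "fr a * g = m3" "fr a * d = m2" "fr b * g = m1" "fr b * d = m0"
proof -
  consider "m3 \<noteq> 0" | "m3 = 0" "m2 \<noteq> 0" | "m3 = 0" "m2 = 0" by blast
  thus ?thesis
  proof cases
    case 1
    obtain b where b: "fr b = m1 / m3" using fr_surj by blast
    have "fr b * m2 = m0" using 1 assms by (simp add: b divide_simps)
    with 1 b show ?thesis by (intro that[of 1 m3 m2 b]) simp_all
  next
    case 2
    obtain b where b: "fr b = m0 / m2" using fr_surj by blast
    with 2 assms show ?thesis by (intro that[of 1 m3 m2 b]) simp_all
  next
    case 3
    thus ?thesis by (intro that[of 0 m1 m0 1]) simp_all
  qed
qed

text \<open>For a real-valued form the coefficients come in conjugate pairs, so singularity is an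
  equality of norms. Hilbert 90 then scales the two factors so that both are traces.\<close>

lemma real_rank_one:
  assumes m: "m3 * cnj m3 = m2 * cnj m2" and nz: "m3 \<noteq> 0 \<or> m2 \<noteq> 0"
  obtains a b where "a \<noteq> 0" "b \<noteq> 0"
    "\<And>x. cnj m3 * fr (cnj x) * cnj x + cnj m2 * fr (cnj x) * x + m2 * fr x * cnj x + m3 * fr x * x
      = fr (tr a x) * tr b x"
proof -
  obtain b where b: "b \<noteq> 0" "b * m2 = m3 * cnj b" using hilbert90[OF m nz] by blast
  obtain a where a: "fr a = m3 / b" using fr_surj by blast
  have a': "fr (cnj a) = cnj m3 / cnj b" using a cnj_fr[of a] by simp
  have "m3 \<noteq> 0" using m nz by auto
  hence "a \<noteq> 0" using a b by auto
  have m2: "m2 = m3 * cnj b / b" using b by (simp add: field_simps)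
  have "cnj m3 * fr (cnj x) * cnj x + cnj m2 * fr (cnj x) * x + m2 * fr x * cnj x + m3 * fr x * x
      = fr (tr a x) * tr b x" for x
    unfolding m2 using b(1) by (simp add: tr_def a a' field_simps)
  with \<open>a \<noteq> 0\<close> b(1) that show ?thesis by blast
qed

section \<open>Linear dependence over the fixed field\<close>

lemma dt_real_left: "cnj r = r \<Longrightarrow> dt (r * a) b = r * dt a b"
  by (simp add: dt_def algebra_simps)

lemma dt_real_right: "cnj r = r \<Longrightarrow> dt a (r * b) = r * dt a b"
  by (simp add: dt_def algebra_simps)

lemma dt_real: "cnj r = r \<Longrightarrow> cnj s = s \<Longrightarrow> dt (r * a) (s * b) = r * s * dt a b"
  by (simp add: dt_real_left dt_real_right)

lemma dt_add_left: "dt (a + b) c = dt a c + dt b c"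
  by (simp add: dt_def algebra_simps)

lemma dt_add_right: "dt a (b + c) = dt a b + dt a c"
  by (simp add: dt_def algebra_simps)

lemma dt_0_left [simp]: "dt 0 a = 0"
  by (simp add: dt_def)

lemma dt_0_right [simp]: "dt a 0 = 0"
  by (simp add: dt_def)

lemma dt_self [simp]: "dt a a = 0"
  by (simp add: dt_def algebra_simps)

text \<open>Cramer's rule again; a quotient of two values of \<open>dt\<close> is fixed because both
  change sign under \<open>cnj\<close>.\<close>

lemma real_combination:
  assumes "dt a c \<noteq> 0"
  obtains r s where "cnj r = r" "cnj s = s" "b = r * a + s * c"
    "dt b c = r * dt a c" "dt a b = s * dt a c"
proof
  show "cnj (dt b c / dt a c) = dt b c / dt a c" "cnj (dt a b / dt a c) = dt a b / dt a c"
    by (simp_all add: cnj_dt)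
  show "b = dt b c / dt a c * a + dt a b / dt a c * c"
    using assms by (simp add: divide_simps) (simp add: dt_def algebra_simps)
qed (use assms in simp_all)

lemma common_zero:
  assumes "dt a b = 0" "a \<noteq> 0"
  obtains x where "x \<noteq> 0" "tr a x = 0" "tr b x = 0"
proof -
  obtain w where w: "cnj w \<noteq> w" using cnj_nontrivial by blast
  \<comment> \<open>The factor \<open>w - cnj w\<close> changes sign under \<open>cnj\<close>, hence
    so does \<open>a * ?x\<close>, and its trace is zero.\<close>
  let ?x = "cnj a * (w - cnj w)"
  have "tr b ?x = - dt a b * (w - cnj w)"
    by (simp add: tr_def dt_def algebra_simps)
  moreover have "tr a ?x = 0" by (simp add: tr_def algebra_simps)
  moreover have "?x \<noteq> 0" using w assms(2) by simp
  ultimately show ?thesis using assms(1) by (intro that[of ?x]) simp_all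
qed

lemma tr_pair_eq_0:
  assumes "dt a b \<noteq> 0" "tr a x = 0" "tr b x = 0"
  shows "x = 0"
proof -
  obtain u v where "\<And>x. x = tr a x * u + tr b x * v"
    using dual_basis[OF assms(1)] by blast
  from this[of x] show ?thesis using assms(2,3) by simp
qed

end

section \<open>Pencils of semilinear forms\<close>

text \<open>\<open>anisotropic\<close> will come from the root condition on \<open>A\<close>.
  \<open>independent\<close> is linear independence of the coefficient vectors of \<open>f\<close>
  and \<open>cnj\<close> of \<open>f\<close>, and will come from \<open>g\<close> being
  nonconstant.\<close>

locale quad_form = conj_field +
  fixes c0 c1 c2 c3 :: 'a
  assumes anisotropic: "c0 * fr (cnj x) * cnj x + c1 * fr (cnj x) * x + c2 * fr x * cnj x
      + c3 * fr x * x = 0 \<Longrightarrow> x = 0"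
    and independent: "s \<noteq> 0 \<or> t \<noteq> 0 \<Longrightarrow>
      \<not> (s * c0 + t * cnj c3 = 0 \<and> s * c1 + t * cnj c2 = 0 \<and>
         s * c2 + t * cnj c1 = 0 \<and> s * c3 + t * cnj c0 = 0)"
begin

definition bil :: "'a \<Rightarrow> 'a \<Rightarrow> 'a" where
  "bil x y = c0 * fr (cnj x) * cnj y + c1 * fr (cnj x) * y + c2 * fr x * cnj y + c3 * fr x * y"

abbreviation f :: "'a \<Rightarrow> 'a" where
  "f x \<equiv> bil x x"

definition plane :: "('a \<times> 'a \<Rightarrow> 'a \<times> 'a) \<Rightarrow> bool" where
  "plane F \<longleftrightarrow> linear_equivalent K (*) UNIV f pair_scale (reals \<times> reals) F"

definition line :: "('a \<Rightarrow> 'a) \<Rightarrow> bool" where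
  "line F \<longleftrightarrow> linear_equivalent K (*) UNIV f (*) UNIV F"

lemma f_eq_0: "f x = 0 \<Longrightarrow> x = 0"
  by (rule anisotropic) (simp add: bil_def)

lemma planeI:
  assumes "dt \<theta> \<phi> \<noteq> 0" "dt a b \<noteq> 0"
    and "\<And>x. F (tr a x, tr b x) = (tr \<theta> (f x), tr \<phi> (f x))"
  shows "plane F"
  unfolding plane_def by (rule linear_equivalentI[OF tr_pair_bij[OF assms(1)] tr_pair_bij[OF assms(2)]]) (rule assms(3))

lemma lineI:
  assumes "s * cnj s \<noteq> t * cnj t" "a * cnj a \<noteq> b * cnj b"
    and "\<And>x. F (a * x + b * cnj x) = s * f x + t * cnj (f x)"
  shows "line F"
  unfolding line_def by (rule linear_equivalentI[OF field_bij[OF assms(1)] field_bij[OF assms(2)]]) (rule assms(3))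

text \<open>A rank-one member of the pencil of \<open>\<F>\<^sub>q\<close>-valued forms \<open>tr \<theta> (f x)\<close>.\<close>

definition splits :: "'a \<Rightarrow> 'a \<Rightarrow> 'a \<Rightarrow> bool" where
  "splits \<theta> a b \<longleftrightarrow> a \<noteq> 0 \<and> b \<noteq> 0 \<and> (\<forall>x. tr \<theta> (f x) = fr (tr a x) * tr b x)"

text \<open>If a factor of one member were proportional to a factor of the other, their common zero
  would be a nontrivial zero of \<open>f\<close>.\<close>

lemma splits_independent:
  assumes "splits \<theta> a b" "splits \<phi> c d" "dt \<theta> \<phi> \<noteq> 0"
  shows "dt a c \<noteq> 0" "dt a d \<noteq> 0" "dt b c \<noteq> 0" "dt b d \<noteq> 0"
proof -
  have *: "dt u v \<noteq> 0" if "u \<in> {a, b}" "v \<in> {c, d}" for u v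
  proof
    assume "dt u v = 0"
    moreover have "u \<noteq> 0" using that assms(1) by (auto simp: splits_def)
    ultimately obtain x where x: "x \<noteq> 0" "tr u x = 0" "tr v x = 0" by (rule common_zero)
    have "tr \<theta> (f x) = 0" "tr \<phi> (f x) = 0"
      using that x assms(1,2) by (auto simp: splits_def)
    hence "f x = 0" by (rule tr_pair_eq_0[OF assms(3)])
    with f_eq_0 x(1) show False by blast
  qed
  show "dt a c \<noteq> 0" "dt a d \<noteq> 0" "dt b c \<noteq> 0" "dt b d \<noteq> 0"
    by (rule *; simp)+
qed

lemma two_splits_P1:
  assumes "splits \<theta> a b" "splits \<phi> c d" "dt \<theta> \<phi> \<noteq> 0" "dt a b = 0" "dt c d \<noteq> 0"
  shows "plane (\<lambda>(x, y). (fr x * x, x * fr y + fr y * y))"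
proof -
  note ind = splits_independent[OF assms(1-3)]
  obtain r s where rs: "cnj r = r" "b = r * a + s * c" "dt b c = r * dt a c" "dt a b = s * dt a c"
    using real_combination[OF ind(1), of b] by blast
  have "s = 0" using rs(4) assms(4) ind(1) by simp
  with rs have b: "cnj r = r" "b = r * a" "dt b c = r * dt a c" by simp_all
  obtain g e where d: "cnj g = g" "cnj e = e" "d = g * a + e * c"
    "dt d c = g * dt a c" "dt a d = e * dt a c"
    using real_combination[OF ind(1), of d] by blast
  have r0: "r \<noteq> 0" using b(3) ind by auto
  have g0: "g \<noteq> 0" using d(4) assms(5) dt_swap[of c d] by auto
  have e0: "e \<noteq> 0" using d(5) ind by auto
  \<comment> \<open>With new coordinates \<open>g / e * tr a x\<close> and \<open>tr c x\<close>,
    these multipliers turn the coefficients \<open>r\<close>, \<open>g\<close>, \<open>e\<close>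
    into ones.\<close>
  let ?u = "fr (g / e) * (g / e) / r" and ?v = "1 / e"
  show ?thesis
  proof (rule planeI)
    show "dt (?u * \<theta>) (?v * \<phi>) \<noteq> 0"
      using r0 g0 e0 assms(3) b d by (subst dt_real) simp_all
    show "dt ((g / e) * a) c \<noteq> 0"
      using g0 e0 ind d by (subst dt_real_left) simp_all
    fix x
    have 1: "tr (?u * \<theta>) (f x) = ?u * (fr (tr a x) * (r * tr a x))"
      using assms(1) b d by (subst tr_real_left) (simp_all add: splits_def tr_real_left)
    have 2: "tr (?v * \<phi>) (f x) = ?v * (fr (tr c x) * (g * tr a x + e * tr c x))"
      using assms(2) d by (subst tr_real_left) (simp_all add: splits_def tr_real_left tr_add_left)
    have 3: "tr ((g / e) * a) x = g / e * tr a x"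
      using d by (subst tr_real_left) simp_all
    show "(case (tr ((g / e) * a) x, tr c x) of (x, y) \<Rightarrow> (fr x * x, x * fr y + fr y * y)) =
      (tr (?u * \<theta>) (f x), tr (?v * \<phi>) (f x))"
      unfolding 1 2 3 using r0 e0 g0 by (simp add: field_simps)
  qed
qed

text \<open>Everything is expressed in the basis \<open>a\<close>, \<open>c\<close>. Independence
  makes \<open>r\<close> and \<open>e\<close> nonzero, and the vanishing of \<open>s\<close> and
  \<open>g\<close> selects the normal form.\<close>

lemma two_splits:
  assumes "splits \<theta> a b" "splits \<phi> c d" "dt \<theta> \<phi> \<noteq> 0"
  shows "plane (\<lambda>(x, y). (fr x * x, fr y * y)) \<or>
    plane (\<lambda>(x, y). (fr x * x, x * fr y + fr y * y)) \<or>
    (\<exists>\<epsilon>\<in>reals - {0} - {-1}. plane (\<lambda>(x, y). (fr x * x - fr x * y, x * fr y + \<epsilon> * (fr y * y))))"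
proof -
  note ind = splits_independent[OF assms]
  obtain r s where b: "cnj r = r" "cnj s = s" "b = r * a + s * c"
    "dt b c = r * dt a c" "dt a b = s * dt a c"
    using real_combination[OF ind(1), of b] by blast
  obtain g e where d: "cnj g = g" "cnj e = e" "d = g * a + e * c"
    "dt d c = g * dt a c" "dt a d = e * dt a c"
    using real_combination[OF ind(1), of d] by blast
  have r0: "r \<noteq> 0" using b(4) ind by auto
  have e0: "e \<noteq> 0" using d(5) ind by auto
  consider "dt a b = 0" "dt c d = 0" | "dt a b = 0" "dt c d \<noteq> 0" | "dt a b \<noteq> 0" "dt c d = 0"
    | "dt a b \<noteq> 0" "dt c d \<noteq> 0" by blast
  thus ?thesis
  proof cases
    case 1
    have "s = 0" "g = 0" using 1 b(5) d(4) ind(1) dt_swap[of c d] by auto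
    have "plane (\<lambda>(x, y). (fr x * x, fr y * y))"
    proof (rule planeI)
      show "dt (1 / r * \<theta>) (1 / e * \<phi>) \<noteq> 0"
        using r0 e0 assms(3) b d by (subst dt_real) simp_all
      show "dt a c \<noteq> 0" by (rule ind)
      fix x
      have 1: "tr (1 / r * \<theta>) (f x) = 1 / r * (fr (tr a x) * (r * tr a x))"
        using assms(1) b \<open>s = 0\<close> by (subst tr_real_left) (simp_all add: splits_def tr_real_left)
      have 2: "tr (1 / e * \<phi>) (f x) = 1 / e * (fr (tr c x) * (e * tr c x))"
        using assms(2) d \<open>g = 0\<close> by (subst tr_real_left) (simp_all add: splits_def tr_real_left)
      show "(case (tr a x, tr c x) of (x, y) \<Rightarrow> (fr x * x, fr y * y)) =
        (tr (1 / r * \<theta>) (f x), tr (1 / e * \<phi>) (f x))"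
        unfolding 1 2 using r0 e0 by simp
    qed
    thus ?thesis by blast
  next
    case 2
    thus ?thesis using two_splits_P1[OF assms] by blast
  next
    case 3
    \<comment> \<open>Exchanging the two members reduces this to the previous case.\<close>
    thus ?thesis using two_splits_P1[OF assms(2,1)] assms(3) dt_swap[of \<theta> \<phi>] by auto
  next
    case 4
    have s0: "s \<noteq> 0" using b(5) 4 by auto
    have g0: "g \<noteq> 0" using d(4) 4 dt_swap[of c d] by auto
    \<comment> \<open>Scaling the second coordinate by \<open>h\<close> makes the first product
      \<open>fr x * (x - y)\<close> up to a constant; \<open>\<epsilon>\<close> is then the
      remaining coefficient of the second.\<close>
    define h where "h = - (s / r)"
    have h: "cnj h = h" "h \<noteq> 0" using r0 s0 b by (simp_all add: h_def)
    define \<epsilon> where "\<epsilon> = e / (g * h)"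
    \<comment> \<open>The value \<open>\<epsilon> = -1\<close> would make this determinant vanish,
      that is, make \<open>b\<close> and \<open>d\<close> proportional.\<close>
    have "dt b d = (r * e - s * g) * dt a c"
      by (simp add: b(3) d(3) dt_def b(1,2) d(1,2) algebra_simps)
    hence "r * e \<noteq> s * g" using ind by auto
    hence "\<epsilon> \<noteq> -1" using r0 s0 g0 by (auto simp: \<epsilon>_def h_def field_simps)
    hence eps: "\<epsilon> \<in> reals - {0} - {-1}"
      using e0 g0 h d by (simp add: \<epsilon>_def reals_def)
    have "plane (\<lambda>(x, y). (fr x * x - fr x * y, x * fr y + \<epsilon> * (fr y * y)))"
    proof (rule planeI)
      show "dt (1 / r * \<theta>) (fr h / g * \<phi>) \<noteq> 0"
        using r0 g0 assms(3) b d h by (subst dt_real) simp_all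
      show "dt a (h * c) \<noteq> 0" using ind h by (simp add: dt_real_right)
      fix x
      have 1: "tr (1 / r * \<theta>) (f x) = 1 / r * (fr (tr a x) * (r * tr a x + s * tr c x))"
        using assms(1) b by (subst tr_real_left) (simp_all add: splits_def tr_real_left tr_add_left)
      have 2: "tr (fr h / g * \<phi>) (f x) = fr h / g * (fr (tr c x) * (g * tr a x + e * tr c x))"
        using assms(2) d h by (subst tr_real_left) (simp_all add: splits_def tr_real_left tr_add_left)
      have 3: "tr (h * c) x = h * tr c x"
        using h by (simp add: tr_real_left)
      show "(case (tr a x, tr (h * c) x) of (x, y) \<Rightarrow> (fr x * x - fr x * y, x * fr y + \<epsilon> * (fr y * y))) =
        (tr (1 / r * \<theta>) (f x), tr (fr h / g * \<phi>) (f x))"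
        unfolding 1 2 3 using r0 g0 h(2) by (simp add: \<epsilon>_def field_simps) (simp add: h_def r0 field_simps)
    qed
    with eps show ?thesis by blast
  qed
qed

section \<open>Singular members of the pencil\<close>

lemma pencil_expand:
  "s * f x + t * cnj (f x) =
     (s * c0 + t * cnj c3) * fr (cnj x) * cnj x + (s * c1 + t * cnj c2) * fr (cnj x) * x +
     (s * c2 + t * cnj c1) * fr x * cnj x + (s * c3 + t * cnj c0) * fr x * x"
  by (simp add: bil_def algebra_simps)

text \<open>The determinant is the binary form \<open>D * s^2 + E * s * t + cnj D * t^2\<close>. Its
  discriminant is fixed by \<open>cnj\<close>, hence a square in the field, so the quadratic formula
  gives a zero.\<close>

lemma pencil_singular:
  obtains s t where "s \<noteq> 0 \<or> t \<noteq> 0"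
    "(s * c0 + t * cnj c3) * (s * c3 + t * cnj c0) = (s * c1 + t * cnj c2) * (s * c2 + t * cnj c1)"
proof (cases "c0 * c3 = c1 * c2")
  case True
  thus ?thesis by (intro that[of 1 0]) simp_all
next
  case False
  define D where "D = c0 * c3 - c1 * c2"
  define E where "E = c0 * cnj c0 + c3 * cnj c3 - c1 * cnj c1 - c2 * cnj c2"
  have D: "D \<noteq> 0" using False by (simp add: D_def)
  have "cnj (E * E - 4 * D * cnj D) = E * E - 4 * D * cnj D"
  proof -
    have "cnj E = E" by (simp add: E_def algebra_simps)
    moreover have "cnj 2 = 2" using cnj_add[of 1 1] by simp
    hence "cnj 4 = 4" using cnj_mult[of 2 2] by simp
    ultimately show ?thesis by (simp add: algebra_simps)
  qed
  then obtain d where d: "d ^ 2 = E * E - 4 * D * cnj D" using real_square by blast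
  define s where "s = (d - E) / (2 * D)"
  have "2 * D * s + E = d" using D char_not_2 by (simp add: s_def)
  hence "(2 * D * s + E) ^ 2 = E * E - 4 * D * cnj D" using d by simp
  hence "(2 * 2) * D * (D * s * s + E * s + cnj D) = 0" by (simp add: power2_eq_square algebra_simps)
  hence "D * s * s + E * s + cnj D = 0" using D char_not_2 by (simp only: mult_eq_0_iff) simp
  hence "(s * c0 + 1 * cnj c3) * (s * c3 + 1 * cnj c0) = (s * c1 + 1 * cnj c2) * (s * c2 + 1 * cnj c1)"
    by (simp add: D_def E_def algebra_simps)
  thus ?thesis by (intro that[of s 1]) simp_all
qed

text \<open>Unequal norms make \<open>s f + t (cnj f)\<close> anisotropic as well, so both linear
  factors are bijective. With the first factor as new variable \<open>y\<close>, the product is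
  \<open>fr y * (A * y + B * cnj y)\<close>, and the vanishing of \<open>A\<close> or
  \<open>B\<close> separates the cases.\<close>

lemma singular_nonreal:
  assumes st: "s * cnj s \<noteq> t * cnj t"
    and det: "(s * c0 + t * cnj c3) * (s * c3 + t * cnj c0) = (s * c1 + t * cnj c2) * (s * c2 + t * cnj c1)"
  shows "line (\<lambda>x. fr x * x) \<or> line (\<lambda>x. fr x * cnj x) \<or>
    (\<exists>\<epsilon>. \<epsilon> \<noteq> 0 \<and> \<epsilon> * cnj \<epsilon> \<noteq> 1 \<and> line (\<lambda>x. fr x * cnj x + \<epsilon> * (fr x * x)))"
proof -
  define L where "L x = s * f x + t * cnj (f x)" for x
  obtain a b g d where "fr a * g = s * c3 + t * cnj c0" "fr a * d = s * c2 + t * cnj c1"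
    "fr b * g = s * c1 + t * cnj c2" "fr b * d = s * c0 + t * cnj c3"
    by (rule rank_one[OF det])
  note m = this(1-4)[symmetric]
  have L: "L x = fr (a * x + b * cnj x) * (g * x + d * cnj x)" for x
    unfolding L_def pencil_expand m by (simp add: algebra_simps)
  have ker: "x = 0" if "L x = 0" for x
    by (rule f_eq_0, rule conj_linear_kernel[OF st]) (use that in \<open>simp add: L_def\<close>)
  have ab: "a * cnj a \<noteq> b * cnj b"
    by (rule norm_neq_of_inj, rule ker) (simp add: L)
  have gd: "x = 0" if "g * x + d * cnj x = 0" for x
    by (rule ker) (simp add: L that)
  define k where "k = a * cnj a - b * cnj b"
  have k: "k \<noteq> 0" using ab by (simp add: k_def)
  \<comment> \<open>\<open>A\<close> and \<open>B\<close> come from solving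
    \<open>y = a * x + b * cnj x\<close> as \<open>x = (cnj a * y - b * cnj y) / k\<close>.\<close>
  define A where "A = (g * cnj a - d * cnj b) / k"
  define B where "B = (d * a - g * b) / k"
  have AB: "A * (a * x + b * cnj x) + B * cnj (a * x + b * cnj x) = g * x + d * cnj x" for x
    using k by (simp add: A_def B_def divide_simps) (simp add: k_def algebra_simps)
  have L': "L x = fr (a * x + b * cnj x) * (A * (a * x + b * cnj x) + B * cnj (a * x + b * cnj x))" for x
    by (simp only: AB L)
  have nAB: "A * cnj A \<noteq> B * cnj B"
  proof (rule norm_neq_of_inj)
    fix y assume y: "A * y + B * cnj y = 0"
    have "surj (\<lambda>x. a * x + b * cnj x)"
      using field_bij[OF ab] by (simp add: linear_bij_def bij_betw_def)
    then obtain x where x: "y = a * x + b * cnj x" by (rule surjE)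
    have "g * x + d * cnj x = 0" using y AB[of x] by (simp only: x)
    hence "x = 0" by (rule gd)
    thus "y = 0" by (simp add: x)
  qed
  have scale: "s / z * cnj (s / z) \<noteq> t / z * cnj (t / z)" if "z \<noteq> 0" for z
    using st that by simp
  have Lz: "s / z * f x + t / z * cnj (f x) = L x / z" for x z
    by (simp add: L_def add_divide_distrib)
  consider "B = 0" "A \<noteq> 0" | "A = 0" "B \<noteq> 0" | "A \<noteq> 0" "B \<noteq> 0"
    using nAB by auto
  thus ?thesis
  proof cases
    case 1
    have "line (\<lambda>x. fr x * x)"
      by (rule lineI[OF scale[OF 1(2)] ab], unfold Lz L') (simp add: 1)
    thus ?thesis by blast
  next
    case 2
    have "line (\<lambda>x. fr x * cnj x)"
      by (rule lineI[OF scale[OF 2(2)] ab], unfold Lz L') (simp add: 2)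
    thus ?thesis by blast
  next
    case 3
    have "line (\<lambda>x. fr x * cnj x + A / B * (fr x * x))"
      by (rule lineI[OF scale[OF 3(2)] ab], unfold Lz L') (use 3 in \<open>simp add: divide_simps\<close>, simp add: algebra_simps)
    moreover have "A / B * cnj (A / B) \<noteq> 1" using nAB 3 by simp
    moreover have "A / B \<noteq> 0" using 3 by simp
    ultimately show ?thesis by blast
  qed
qed

text \<open>Hilbert 90 rescales \<open>(s, t)\<close> to \<open>(\<theta>, cnj \<theta>)\<close>,
  which turns the singular member into the real-valued form \<open>tr \<theta> (f x)\<close>. It is
  nonzero by \<open>independent\<close>.\<close>

lemma singular_real:
  assumes st: "s * cnj s = t * cnj t" "s \<noteq> 0 \<or> t \<noteq> 0"
    and det: "(s * c0 + t * cnj c3) * (s * c3 + t * cnj c0) = (s * c1 + t * cnj c2) * (s * c2 + t * cnj c1)"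
  obtains \<theta> a b where "\<theta> \<noteq> 0" "splits \<theta> a b"
proof -
  obtain \<theta> where \<theta>: "\<theta> \<noteq> 0" "\<theta> * t = s * cnj \<theta>" using hilbert90[OF st] by blast
  have s: "s \<noteq> 0" using st by auto
  define l where "l = \<theta> / s"
  have l: "\<theta> = l * s" "cnj \<theta> = l * t" using \<theta> s by (simp_all add: l_def field_simps)
  define m3 where "m3 = \<theta> * c3 + cnj \<theta> * cnj c0"
  define m2 where "m2 = \<theta> * c2 + cnj \<theta> * cnj c1"
  have cm: "cnj m3 = \<theta> * c0 + cnj \<theta> * cnj c3" "cnj m2 = \<theta> * c1 + cnj \<theta> * cnj c2"
    by (simp_all add: m3_def m2_def)
  have "m3 * cnj m3 = l * l * ((s * c0 + t * cnj c3) * (s * c3 + t * cnj c0))"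
    unfolding cm unfolding m3_def unfolding l(2) unfolding l(1) by (simp add: algebra_simps)
  also have "\<dots> = m2 * cnj m2"
    unfolding det cm unfolding m2_def unfolding l(2) unfolding l(1) by (simp add: algebra_simps)
  finally have "m3 * cnj m3 = m2 * cnj m2" .
  moreover have "m3 \<noteq> 0 \<or> m2 \<noteq> 0"
  proof (rule ccontr)
    assume "\<not> (m3 \<noteq> 0 \<or> m2 \<noteq> 0)"
    hence "m3 = 0" "m2 = 0" "cnj m3 = 0" "cnj m2 = 0" by simp_all
    with independent[of \<theta> "cnj \<theta>"] \<theta>(1) show False unfolding cm unfolding m3_def m2_def by blast
  qed
  ultimately obtain a b where ab: "a \<noteq> 0" "b \<noteq> 0"
    "\<And>x. cnj m3 * fr (cnj x) * cnj x + cnj m2 * fr (cnj x) * x + m2 * fr x * cnj x + m3 * fr x * x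
      = fr (tr a x) * tr b x"
    using real_rank_one[of m3 m2] by blast
  have split: "tr \<theta> (f x) = fr (tr a x) * tr b x" for x
    unfolding ab(3)[symmetric] cm unfolding m3_def m2_def tr_def[of \<theta>] by (rule pencil_expand)
  have "splits \<theta> a b"
    unfolding splits_def using ab(1,2) split by blast
  with \<theta>(1) show ?thesis by (rule that)
qed

section \<open>Normal forms starting from one split member\<close>

lemma coordinates:
  assumes "dt a b \<noteq> 0"
  obtains u v where "tr a u = 1" "tr b u = 0" "tr a v = 0" "tr b v = 1"
    "\<And>\<phi> x. tr \<phi> (f x) = tr \<phi> (f u) * (fr (tr a x) * tr a x) + tr \<phi> (bil u v) * (fr (tr a x) * tr b x)
      + tr \<phi> (bil v u) * (fr (tr b x) * tr a x) + tr \<phi> (f v) * (fr (tr b x) * tr b x)"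
proof -
  obtain u v where uv: "tr a u = 1" "tr b u = 0" "tr a v = 0" "tr b v = 1"
    and x: "\<And>x. x = tr a x * u + tr b x * v"
    using dual_basis[OF assms] by blast
  have "tr \<phi> (f x) = tr \<phi> (f u) * (fr (tr a x) * tr a x) + tr \<phi> (bil u v) * (fr (tr a x) * tr b x)
      + tr \<phi> (bil v u) * (fr (tr b x) * tr a x) + tr \<phi> (f v) * (fr (tr b x) * tr b x)" for \<phi> x
  proof -
    define y z where yz: "y = tr a x" "z = tr b x"
    have r: "cnj y = y" "cnj z = z" by (simp_all add: yz)
    have x': "x = y * u + z * v" using x[of x] by (simp add: yz)
    have "f x = fr y * y * f u + fr y * z * bil u v + fr z * y * bil v u + fr z * z * f v"
      unfolding x' bil_def by (simp add: r algebra_simps)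
    thus ?thesis by (simp add: tr_add_right tr_real_right r flip: yz)
  qed
  with uv that show ?thesis by blast
qed

text \<open>Singularity makes the row \<open>(m, n)\<close> a multiple \<open>k\<close> of
  \<open>(r, w)\<close>. With \<open>fr e = k\<close> the form factors as
  \<open>fr (e * X + Y) * (r * X + w * Y)\<close>.\<close>

lemma splits_of_form:
  assumes "dt a b \<noteq> 0"
    and "\<And>x. tr \<phi> (f x) = m * (fr (tr a x) * tr a x) + n * (fr (tr a x) * tr b x)
      + r * (fr (tr b x) * tr a x) + w * (fr (tr b x) * tr b x)"
    and "cnj m = m" "cnj n = n" "cnj r = r" "cnj w = w" "m * w = n * r" "r \<noteq> 0 \<or> w \<noteq> 0"
  obtains c d where "splits \<phi> c d"
proof -
  define k where "k = (if r \<noteq> 0 then m / r else n / w)"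
  have k: "m = k * r" "n = k * w" using assms(7,8) by (auto simp: k_def divide_simps mult_ac)
  have "cnj k = k" using assms(3-6) by (simp add: k_def)
  then obtain e where e: "fr e = k" "cnj e = e" by (rule fr_real_root)
  let ?c = "e * a + b" and ?d = "r * a + w * b"
  have "dt a ?c = dt a b"
    using e by (simp add: dt_add_right dt_real_right)
  with assms(1) have c: "?c \<noteq> 0" by (metis dt_0_right)
  have "dt a ?d = w * dt a b" "dt ?d b = r * dt a b"
    using assms(5,6) by (simp_all add: dt_add_right dt_real_right dt_add_left dt_real_left)
  with assms(1,8) have d: "?d \<noteq> 0" by (metis dt_0_right dt_0_left mult_eq_0_iff)
  have "tr \<phi> (f x) = fr (tr ?c x) * tr ?d x" for x
    unfolding assms(2) k tr_add_left tr_real_left[OF assms(5)] tr_real_left[OF assms(6)]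
      tr_real_left[OF e(2)] by (simp add: e(1) algebra_simps)
  with c d show ?thesis by (intro that[of ?c ?d]) (simp add: splits_def)
qed

text \<open>Adding \<open>s * \<theta>\<close> to an independent \<open>\<phi>\<close> changes only
  one coefficient when coordinates are adapted to \<open>a\<close> and \<open>b\<close>. Choosing
  \<open>s\<close> to kill the determinant gives a second split member; where the determinant does
  not depend on \<open>s\<close>, the pencil is brought to \<open>P_2\<close> directly.\<close>

lemma splits_classification:
  assumes \<theta>: "\<theta> \<noteq> 0" and sp: "splits \<theta> a b"
  shows "plane (\<lambda>(x, y). (fr x * x, fr y * y)) \<or>
    plane (\<lambda>(x, y). (fr x * x, x * fr y + fr y * y)) \<or>
    (\<exists>\<epsilon>\<in>reals - {0}. plane (\<lambda>(x, y). (fr x * y, fr x * x + \<epsilon> * (fr y * y)))) \<or>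
    (\<exists>\<epsilon>\<in>reals - {0} - {-1}. plane (\<lambda>(x, y). (fr x * x - fr x * y, x * fr y + \<epsilon> * (fr y * y))))"
proof -
  obtain \<phi> where \<phi>: "dt \<theta> \<phi> \<noteq> 0" using dt_nonzero_ex[OF \<theta>] by blast
  have shift: "dt \<theta> (\<phi> + s * \<theta>) \<noteq> 0" if "cnj s = s" for s
    using \<phi> that by (simp add: dt_add_right dt_real_right)
  have tr_shift: "tr (\<phi> + s * \<theta>) (f x) = tr \<phi> (f x) + s * (fr (tr a x) * tr b x)" if "cnj s = s" for s x
    using that sp by (simp add: tr_add_left tr_real_left splits_def)
  have nz: "tr \<phi> (f x) \<noteq> 0" if "tr \<theta> (f x) = 0" "x \<noteq> 0" for x
    using tr_pair_eq_0[OF \<phi> that(1)] f_eq_0[of x] that(2) by blast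
  show ?thesis
  proof (cases "dt a b = 0")
    case False
    obtain u v where uv: "tr a u = 1" "tr b u = 0" "tr a v = 0" "tr b v = 1" and
      co: "\<And>\<phi> x. tr \<phi> (f x) = tr \<phi> (f u) * (fr (tr a x) * tr a x) + tr \<phi> (bil u v) * (fr (tr a x) * tr b x)
      + tr \<phi> (bil v u) * (fr (tr b x) * tr a x) + tr \<phi> (f v) * (fr (tr b x) * tr b x)"
      using coordinates[OF False] by blast
    define m n r w where defs: "m = tr \<phi> (f u)" "n = tr \<phi> (bil u v)" "r = tr \<phi> (bil v u)" "w = tr \<phi> (f v)"
    have re: "cnj m = m" "cnj n = n" "cnj r = r" "cnj w = w" by (simp_all add: defs)
    have uv0: "u \<noteq> 0" "v \<noteq> 0" using uv by auto
    \<comment> \<open>At a nonzero zero of \<open>tr \<theta> (f x)\<close> the independent form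
      cannot vanish too, so both diagonal coefficients survive.\<close>
    have "tr \<theta> (f u) = 0" "tr \<theta> (f v) = 0" using sp uv by (simp_all add: splits_def)
    hence mw: "m \<noteq> 0" "w \<noteq> 0" using nz uv0 by (simp_all add: defs)
    show ?thesis
    proof (cases "r = 0")
      case True
      \<comment> \<open>With \<open>r = 0\<close> the determinant is \<open>m * w\<close> for every
        shift. Subtracting \<open>n * \<theta>\<close> removes the mixed term, and division by
        \<open>m\<close> normalises the rest.\<close>
      have "plane (\<lambda>(x, y). (fr x * y, fr x * x + w / m * (fr y * y)))"
      proof (rule planeI)
        have "dt (1 * \<theta>) (1 / m * (\<phi> + (- n) * \<theta>)) = 1 * (1 / m) * dt \<theta> (\<phi> + (- n) * \<theta>)"
          using re by (intro dt_real) simp_all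
        thus "dt \<theta> (1 / m * (\<phi> + (- n) * \<theta>)) \<noteq> 0" using shift[of "- n"] mw re by simp
        show "dt a b \<noteq> 0" by fact
        fix x
        have 1: "tr (1 / m * (\<phi> + (- n) * \<theta>)) (f x) = 1 / m * (tr \<phi> (f x) + (- n) * (fr (tr a x) * tr b x))"
          using re by (subst tr_real_left) (simp_all add: tr_shift del: mult_minus_left)
        show "(case (tr a x, tr b x) of (x, y) \<Rightarrow> (fr x * y, fr x * x + w / m * (fr y * y))) =
          (tr \<theta> (f x), tr (1 / m * (\<phi> + (- n) * \<theta>)) (f x))"
          unfolding 1 co[of \<phi> x] defs[symmetric] using sp True mw by (simp add: splits_def field_simps)
      qed
      moreover have "w / m \<in> reals - {0}" using re mw by (simp add: reals_def)
      ultimately show ?thesis by blast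
    next
      case r: False
      define s where "s = m * w / r - n"
      have s: "cnj s = s" using re by (simp add: s_def)
      obtain c d where "splits (\<phi> + s * \<theta>) c d"
      proof (rule splits_of_form[OF False])
        show "tr (\<phi> + s * \<theta>) (f x) = m * (fr (tr a x) * tr a x) + (n + s) * (fr (tr a x) * tr b x)
          + r * (fr (tr b x) * tr a x) + w * (fr (tr b x) * tr b x)" for x
          unfolding tr_shift[OF s] co[of \<phi> x] defs[symmetric] by (simp add: algebra_simps)
        show "m * w = (n + s) * r" using r by (simp add: s_def)
      qed (use re s r in simp_all)
      with two_splits[OF sp this shift[OF s]] show ?thesis by blast
    qed
  next
    case True
    have a: "a \<noteq> 0" "b \<noteq> 0" using sp by (simp_all add: splits_def)
    \<comment> \<open>Here \<open>tr b\<close> is a fixed-field multiple of \<open>tr a\<close>, so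
      shifting by \<open>\<theta>\<close> alters the coefficient \<open>m\<close>; as
      \<open>w\<close> is nonzero, the determinant can always be killed.\<close>
    define h where "h = b / a"
    have h: "cnj h = h" "h \<noteq> 0" "b = h * a"
      using a True by (simp_all add: h_def dt_def field_simps)
    obtain b' where b': "dt a b' \<noteq> 0" using dt_nonzero_ex[OF a(1)] by blast
    obtain u v where uv: "tr a u = 1" "tr b' u = 0" "tr a v = 0" "tr b' v = 1" and
      co: "\<And>\<phi> x. tr \<phi> (f x) = tr \<phi> (f u) * (fr (tr a x) * tr a x) + tr \<phi> (bil u v) * (fr (tr a x) * tr b' x)
      + tr \<phi> (bil v u) * (fr (tr b' x) * tr a x) + tr \<phi> (f v) * (fr (tr b' x) * tr b' x)"
      using coordinates[OF b'] by blast
    define m n r w where defs: "m = tr \<phi> (f u)" "n = tr \<phi> (bil u v)" "r = tr \<phi> (bil v u)" "w = tr \<phi> (f v)"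
    have re: "cnj m = m" "cnj n = n" "cnj r = r" "cnj w = w" by (simp_all add: defs)
    have "v \<noteq> 0" using uv by auto
    moreover have "tr \<theta> (f v) = 0" using sp uv by (simp add: splits_def)
    ultimately have w: "w \<noteq> 0" using nz by (simp add: defs)
    define s where "s = (n * r / w - m) / h"
    have s: "cnj s = s" using re h by (simp add: s_def)
    have b_tr: "tr b x = h * tr a x" for x using h by (simp add: tr_real_left)
    obtain c d where "splits (\<phi> + s * \<theta>) c d"
    proof (rule splits_of_form[OF b'])
      show "tr (\<phi> + s * \<theta>) (f x) = (m + s * h) * (fr (tr a x) * tr a x) + n * (fr (tr a x) * tr b' x)
        + r * (fr (tr b' x) * tr a x) + w * (fr (tr b' x) * tr b' x)" for x
        unfolding tr_shift[OF s] co[of \<phi> x] defs[symmetric] b_tr by (simp add: algebra_simps)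
      show "(m + s * h) * w = n * r" using w h by (simp add: s_def)
    qed (use re s w h in simp_all)
    with two_splits[OF sp this shift[OF s]] show ?thesis by blast
  qed
qed

text \<open>The members \<open>[s : t]\<close> defined over the fixed field are those with
  \<open>s * cnj s = t * cnj t\<close>, so comparing norms decides which analysis applies.\<close>

lemma classification:
  "plane (\<lambda>(x, y). (fr x * x, fr y * y)) \<or>
   line (\<lambda>x. fr x * x) \<or>
   line (\<lambda>x. fr x * cnj x) \<or>
   plane (\<lambda>(x, y). (fr x * x, x * fr y + fr y * y)) \<or>
   (\<exists>\<epsilon>\<in>reals - {0}. plane (\<lambda>(x, y). (fr x * y, fr x * x + \<epsilon> * (fr y * y)))) \<or>
   (\<exists>\<epsilon>\<in>reals - {0} - {-1}. plane (\<lambda>(x, y). (fr x * x - fr x * y, x * fr y + \<epsilon> * (fr y * y)))) \<or>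
   (\<exists>\<epsilon>. \<epsilon> \<noteq> 0 \<and> \<epsilon> * cnj \<epsilon> \<noteq> 1 \<and> line (\<lambda>x. fr x * cnj x + \<epsilon> * (fr x * x)))"
proof -
  obtain s t where st: "s \<noteq> 0 \<or> t \<noteq> 0"
    and det: "(s * c0 + t * cnj c3) * (s * c3 + t * cnj c0) = (s * c1 + t * cnj c2) * (s * c2 + t * cnj c1)"
    by (rule pencil_singular)
  show ?thesis
  proof (cases "s * cnj s = t * cnj t")
    case True
    then obtain \<theta> a b where "\<theta> \<noteq> 0" "splits \<theta> a b" using singular_real st det by blast
    from splits_classification[OF this] show ?thesis by blast
  next
    case False
    from singular_nonreal[OF this det] show ?thesis by blast
  qed
qed

end

section \<open>Frobenius maps of a finite field\<close>

text \<open>Multiplication by a nonzero \<open>x\<close> permutes the nonzero elements; comparing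
  their products gives the exponent.\<close>

lemma finite_field_power_CARD:
  fixes x :: "'a::{field,finite}"
  shows "x ^ CARD('a) = x"
proof (cases "x = 0")
  case False
  have "(\<Prod>y\<in>UNIV - {0}. y) = (\<Prod>y\<in>UNIV - {0}. x * y)"
    by (rule prod.reindex_bij_witness[of _ "\<lambda>y. x * y" "\<lambda>y. y / x"]) (use False in auto)
  also have "\<dots> = x ^ (CARD('a) - 1) * (\<Prod>y\<in>UNIV - {0}. y)"
    by (simp add: prod.distrib card_Diff_singleton)
  finally have "x ^ (CARD('a) - 1) = 1" by simp
  moreover have "CARD('a) = Suc (CARD('a) - 1)" by simp
  ultimately show ?thesis by (metis power_Suc mult.right_neutral)
qed simp

lemma card_powers_eq_1:
  assumes "n > 0"
  shows "card {x::'a::{field,finite}. x ^ n = 1} \<le> n"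
proof -
  let ?p = "Polynomial.monom 1 n - 1 :: 'a poly"
  have "coeff ?p n = 1" using assms by simp
  hence "?p \<noteq> 0" by (metis coeff_0 zero_neq_one)
  hence "card {x. poly ?p x = 0} \<le> degree ?p" by (rule card_poly_roots_bound)
  also have "degree ?p \<le> n" by (intro degree_diff_le degree_monom_le) simp
  finally show ?thesis by (simp add: poly_monom)
qed

text \<open>Nonzero squares lie among the at most \<open>n\<close> roots of \<open>X^n = 1\<close>.
  A nonsquare root \<open>a\<close> would leave fewer than \<open>n\<close> squares, too few because
  squaring is at most two-to-one on \<open>2 * n\<close> elements.\<close>

lemma finite_field_square:
  fixes a :: "'a::{field,finite}"
  assumes card: "CARD('a) = 2 * n + 1" and a: "a = 0 \<or> a ^ n = 1"
  shows "\<exists>d. d ^ 2 = a"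
proof (rule ccontr)
  assume no: "\<nexists>d. d ^ 2 = a"
  hence "a \<noteq> 0" by (metis zero_power2)
  define S where "S = (\<lambda>x::'a. x ^ 2) ` (UNIV - {0})"
  have "CARD('a) > 1"
    using card_mono[of UNIV "{0, 1 :: 'a}"] by simp
  hence n: "n > 0" using card by simp
  have pow: "x ^ (2 * n) = 1" if "x \<noteq> 0" for x :: 'a
    using finite_field_power_CARD[of x] that by (simp add: card)
  have "insert a S \<subseteq> {x. x ^ n = 1}"
    using a \<open>a \<noteq> 0\<close> pow by (auto simp: S_def simp flip: power_mult)
  hence "card (insert a S) \<le> n"
    using card_mono[OF finite] card_powers_eq_1[OF n, where ?'a = 'a] le_trans by blast
  moreover have "a \<notin> S" using no by (auto simp: S_def)
  ultimately have S: "card S < n" by simp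
  have fib: "card {x::'a. x ^ 2 = s} \<le> 2" for s
  proof (cases "\<exists>y. y ^ 2 = s")
    case True
    then obtain y where "y ^ 2 = s" by blast
    hence "{x. x ^ 2 = s} \<subseteq> {y, - y}" by (auto simp: power2_eq_iff)
    hence "card {x. x ^ 2 = s} \<le> card {y, - y}" by (intro card_mono) simp_all
    also have "\<dots> \<le> 2" by (simp add: card_insert_if)
    finally show ?thesis .
  qed simp
  have "UNIV - {0} \<subseteq> (\<Union>s\<in>S. {x::'a. x ^ 2 = s})" by (auto simp: S_def)
  hence "card (UNIV - {0::'a}) \<le> card (\<Union>s\<in>S. {x::'a. x ^ 2 = s})" by (intro card_mono) simp_all
  also have "\<dots> \<le> (\<Sum>s\<in>S. card {x::'a. x ^ 2 = s})" by (rule card_UN_le) simp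
  also have "\<dots> \<le> (\<Sum>s\<in>S. 2)" by (intro sum_mono fib)
  also have "\<dots> < 2 * n" using S by simp
  finally show False using card by (simp add: card_Diff_singleton)
qed

lemma poly_map_poly_to_ac: "poly (map_poly to_ac p) (to_ac z) = to_ac (poly p z)"
  by (induction p) (simp_all add: map_poly_pCons)

lemma conj_field_frobenius:
  assumes p: "prime p" "odd p" and k: "k > 0" and q: "q = p ^ k" and Q: "Q = p ^ l"
    and card: "CARD('a::{field,finite}) = q ^ 2"
  shows "conj_field (\<lambda>x::'a. x ^ q) (\<lambda>x. x ^ Q) (subfield_of_order p)"
proof
  have char: "prime CHAR('a)"
    by (rule prime_CHAR_semidom) (rule finite_imp_CHAR_pos, simp)
  have "CHAR('a) dvd (p ^ k) ^ 2"
    using CHAR_dvd_CARD[where ?'a = 'a] by (simp only: card q)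
  hence "CHAR('a) dvd p" using char prime_dvd_power by blast
  hence cp: "CHAR('a) = p" using char p(1) by (simp add: primes_dvd_imp_eq)
  show "(x + y) ^ q = x ^ q + y ^ q" for x y :: 'a
    by (rule freshmans_dream'[OF char]) (simp add: cp q)
  show "(x + y) ^ Q = x ^ Q + y ^ Q" for x y :: 'a
    by (rule freshmans_dream'[OF char]) (simp add: cp Q)
  show qq: "(x ^ q) ^ q = x" for x :: 'a
    using finite_field_power_CARD[of x] by (simp add: card power2_eq_square power_mult)
  have q1: "q > 1" unfolding q using prime_gt_1_nat[OF p(1)] k by (rule one_less_power)
  show "\<exists>x::'a. x ^ q \<noteq> x"
  proof (rule ccontr)
    assume "\<nexists>x::'a. x ^ q \<noteq> x"
    hence x: "x ^ q = x" for x :: 'a by blast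
    \<comment> \<open>Otherwise all \<open>q^2 - 1\<close> nonzero elements would be roots of unity
      of order dividing \<open>q - 1\<close>.\<close>
    have "x ^ (q - 1) = 1" if "x \<noteq> 0" for x :: 'a
    proof -
      have "x * x ^ (q - 1) = x ^ q" using q1 by (simp flip: power_Suc)
      also have "\<dots> = x * 1" by (simp add: x)
      finally show ?thesis using that by simp
    qed
    hence "UNIV - {0} \<subseteq> {x::'a. x ^ (q - 1) = 1}" by auto
    hence "card (UNIV - {0::'a}) \<le> card {x::'a. x ^ (q - 1) = 1}" by (intro card_mono) simp_all
    also have "\<dots> \<le> q - 1" using q1 by (intro card_powers_eq_1) simp
    finally have "q ^ 2 - 1 \<le> q - 1" by (simp add: card_Diff_singleton card)
    moreover have "q < q ^ 2" using q1 by (simp add: power2_eq_square)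
    ultimately show False using q1 by linarith
  qed
  show "\<exists>d. d ^ 2 = a" if "a ^ q = a" for a :: 'a
  proof -
    have "odd q" using p(2) by (simp add: q)
    then obtain m where m: "q = 2 * m + 1" by (rule oddE)
    show ?thesis
    proof (rule finite_field_square)
      \<comment> \<open>For \<open>q = 2 * m + 1\<close>, half of \<open>q^2 - 1\<close> is a
        multiple of \<open>q - 1 = 2 * m\<close>, so nonzero elements of the fixed field pass the
        square test.\<close>
      show "CARD('a) = 2 * (2 * m * (m + 1)) + 1"
        unfolding card m by (simp add: power2_eq_square algebra_simps)
      have "a * a ^ (2 * m) = a" using that by (simp add: m)
      hence "a = 0 \<or> a ^ (2 * m) = 1" by simp
      thus "a = 0 \<or> a ^ (2 * m * (m + 1)) = 1" by (auto simp only: power_mult power_one)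
    qed
  qed
  show "(2::'a) \<noteq> 0"
  proof
    assume "(2::'a) = 0"
    hence "of_nat 2 = (0::'a)" by simp
    hence "p dvd 2" by (simp only: of_nat_eq_0_iff_char_dvd cp)
    hence "p \<le> 2" by (rule dvd_imp_le) simp
    with p prime_ge_2_nat[of p] have "p = 2" by simp
    with p show False by simp
  qed
  show "r ^ q = r" if "r \<in> subfield_of_order p" for r :: 'a
  proof -
    have "r ^ (p ^ j) = r" for j
      by (induction j) (use that in \<open>simp_all add: subfield_of_order_def power_mult\<close>)
    thus ?thesis by (simp add: q)
  qed
qed (simp_all add: power_mult_distrib mult.commute flip: power_mult)

section \<open>Translating the hypotheses on \<open>A\<close> and \<open>g\<close>\<close>

lemma f_fun_eq_A_poly:
  fixes x :: "'a::field"
  assumes "x ^ q = x * z"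
  shows "f_fun q Q (c0, c1, c2, c3) x = x ^ (Q + 1) * poly (A_poly Q (c0, c1, c2, c3)) z"
proof -
  have "x ^ (q * Q) = x ^ Q * z ^ Q" by (simp add: power_mult assms power_mult_distrib)
  thus ?thesis by (simp add: power_add assms poly_monom algebra_simps)
qed

text \<open>For nonzero \<open>x\<close> the quotient \<open>z = x^q / x\<close> is a
  \<open>(q + 1)\<close>-th root of unity, and \<open>f\<close> at \<open>x\<close> is
  \<open>x^(Q + 1)\<close> times \<open>A\<close> at \<open>z\<close>.\<close>

lemma f_fun_zero_free:
  fixes c :: "'a::{field,finite} \<times> 'a \<times> 'a \<times> 'a"
  assumes card: "CARD('a) = q ^ 2"
    and A: "\<forall>z \<in> (roots_of_unity (q + 1) :: 'a alg_closure set). poly (map_poly to_ac (A_poly Q c)) z \<noteq> 0"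
    and f: "f_fun q Q c x = 0"
  shows "x = 0"
proof (rule ccontr)
  assume x: "x \<noteq> 0"
  define z where "z = x ^ q / x"
  have z: "x ^ q = x * z" using x by (simp add: z_def)
  have "x ^ (q * q) = x"
    using finite_field_power_CARD[of x] by (simp add: card power2_eq_square)
  hence "z ^ (q + 1) = 1"
    using x by (simp add: z_def power_divide power_add power_mult field_simps)
  hence "to_ac z \<in> roots_of_unity (q + 1)"
    unfolding roots_of_unity_def mem_Collect_eq to_ac_power[symmetric] by simp
  with A have "poly (map_poly to_ac (A_poly Q c)) (to_ac z) \<noteq> 0" by blast
  hence "poly (A_poly Q c) z \<noteq> 0" by (simp add: poly_map_poly_to_ac)
  moreover obtain c0 c1 c2 c3 where "c = (c0, c1, c2, c3)" by (metis prod.exhaust)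
  ultimately show False using f x f_fun_eq_A_poly[OF z, of Q] by simp
qed

text \<open>A relation with \<open>t\<close> nonzero says that \<open>B\<close> is a constant
  multiple of \<open>A\<close>; one with \<open>t = 0\<close> forces all coefficients to
  vanish.\<close>

lemma nonconstant_independent:
  fixes c0 c1 c2 c3 :: "'a::field"
  assumes c: "(c0, c1, c2, c3) \<noteq> 0" and Q: "Q > 1"
    and g: "\<not> constant_fract (g_fract q Q (c0, c1, c2, c3))"
    and st: "s \<noteq> 0 \<or> t \<noteq> 0"
    and eqs: "s * c0 + t * c3 ^ q = 0" "s * c1 + t * c2 ^ q = 0" "s * c2 + t * c1 ^ q = 0"
      "s * c3 + t * c0 ^ q = 0"
  shows False
proof (cases "t = 0")
  case True
  with st eqs c show False by (simp add: zero_prod_def)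
next
  case False
  define u where "u = - s / t"
  have B: "c3 ^ q = u * c0" "c2 ^ q = u * c1" "c1 ^ q = u * c2" "c0 ^ q = u * c3"
    using eqs False by (simp_all add: u_def field_simps eq_neg_iff_add_eq_0)
  have "B_poly q Q (c0, c1, c2, c3) = [:u:] * A_poly Q (c0, c1, c2, c3)"
    by (simp add: B smult_add_right smult_monom)
  moreover have "A_poly Q (c0, c1, c2, c3) \<noteq> 0"
  proof
    assume 0: "A_poly Q (c0, c1, c2, c3) = 0"
    \<comment> \<open>\<open>Q > 1\<close> keeps the exponents \<open>Q + 1\<close>,
      \<open>Q\<close>, \<open>1\<close>, \<open>0\<close> distinct, so no coefficients
      merge.\<close>
    have "coeff (A_poly Q (c0, c1, c2, c3)) (Q + 1) = c0" "coeff (A_poly Q (c0, c1, c2, c3)) Q = c1"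
      "coeff (A_poly Q (c0, c1, c2, c3)) 1 = c2" "coeff (A_poly Q (c0, c1, c2, c3)) 0 = c3"
      using Q by (simp_all add: coeff_monom)
    hence "c0 = 0 \<and> c1 = 0 \<and> c2 = 0 \<and> c3 = 0" unfolding 0 by simp
    with c show False by (simp add: zero_prod_def)
  qed
  ultimately have "g_fract q Q (c0, c1, c2, c3) = Fract [:u:] 1"
    unfolding g_fract_def by (subst eq_fract) simp_all
  with g show False by (auto simp: constant_fract_def)
qed

theorem theorem5p2:
  fixes p k l q Q :: nat
    and c :: "'a::{field,finite} \<times> 'a \<times> 'a \<times> 'a"
  assumes "prime p" and "odd p" and "k > 0" and "l > 0"
    and "q = p ^ k" and "Q = p ^ l"
    and "CARD('a) = q ^ 2"
    and "c \<noteq> 0"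
    and "\<not> constant_fract (g_fract q Q c)"
    and "\<forall>z \<in> (roots_of_unity (q + 1) :: 'a alg_closure set).
           poly (map_poly to_ac (A_poly Q c)) z \<noteq> 0"
  shows
    "lin_equiv_plane p q (f_fun q Q c) (\<lambda>(x, y). (x ^ (Q + 1), y ^ (Q + 1))) \<or>
     lin_equiv_field p (f_fun q Q c) (\<lambda>x. x ^ (Q + 1)) \<or>
     lin_equiv_field p (f_fun q Q c) (\<lambda>x. x ^ (Q + q)) \<or>
     lin_equiv_plane p q (f_fun q Q c)
       (\<lambda>(x, y). (x ^ (Q + 1), x * y ^ Q + y ^ (Q + 1))) \<or>
     (\<exists>\<epsilon> \<in> subfield_of_order q - {0}.
        lin_equiv_plane p q (f_fun q Q c)
          (\<lambda>(x, y). (x ^ Q * y, x ^ (Q + 1) + \<epsilon> * y ^ (Q + 1)))) \<or>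
     (\<exists>\<epsilon> \<in> subfield_of_order q - {0} - {-1}.
        lin_equiv_plane p q (f_fun q Q c)
          (\<lambda>(x, y). (x ^ (Q + 1) - x ^ Q * y, x * y ^ Q + \<epsilon> * y ^ (Q + 1)))) \<or>
     (\<exists>\<epsilon>. \<epsilon> \<noteq> 0 \<and> to_ac \<epsilon> \<notin> roots_of_unity (q + 1) \<and>
        lin_equiv_field p (f_fun q Q c) (\<lambda>x. x ^ (Q + q) + \<epsilon> * x ^ (Q + 1)))"
proof -
  obtain c0 c1 c2 c3 where c: "c = (c0, c1, c2, c3)" by (metis prod.exhaust)
  interpret conj_field "\<lambda>x::'a. x ^ q" "\<lambda>x. x ^ Q" "subfield_of_order p"
    by (rule conj_field_frobenius[OF assms(1-3,5-7)])
  have Q: "Q > 1"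
    unfolding assms(6) using prime_gt_1_nat[OF assms(1)] assms(4) by (rule one_less_power)
  have qQ: "x ^ (Q + 1) = x ^ Q * x" "x ^ (Q + q) = x ^ Q * x ^ q" for x :: 'a
    by (simp_all add: power_add)
  interpret quad_form "\<lambda>x::'a. x ^ q" "\<lambda>x. x ^ Q" "subfield_of_order p" c0 c1 c2 c3
  proof
    fix x :: 'a
    assume "c0 * (x ^ q) ^ Q * x ^ q + c1 * (x ^ q) ^ Q * x + c2 * x ^ Q * x ^ q + c3 * x ^ Q * x = 0"
    hence "f_fun q Q c x = 0" by (simp add: c power_add power_mult mult_ac)
    thus "x = 0" by (rule f_fun_zero_free[OF assms(7,10)])
  next
    fix s t :: 'a
    assume "s \<noteq> 0 \<or> t \<noteq> 0"
    thus "\<not> (s * c0 + t * c3 ^ q = 0 \<and> s * c1 + t * c2 ^ q = 0 \<and>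
         s * c2 + t * c1 ^ q = 0 \<and> s * c3 + t * c0 ^ q = 0)"
      using nonconstant_independent[OF assms(8)[unfolded c] Q assms(9)[unfolded c]] by blast
  qed
  have f: "f_fun q Q c = f"
    by (rule ext) (simp add: c bil_def power_add power_mult mult_ac)
  \<comment> \<open>The norm of \<open>\<epsilon>\<close> is its \<open>(q + 1)\<close>-th power,
    and the embedding \<open>to_ac\<close> is injective.\<close>
  have root: "to_ac \<epsilon> \<notin> roots_of_unity (q + 1)" if "\<epsilon> * \<epsilon> ^ q \<noteq> 1" for \<epsilon> :: 'a
    using that unfolding roots_of_unity_def mem_Collect_eq to_ac_power[symmetric]
    by (simp del: to_ac_power to_ac_mult)
  show ?thesis
    using classification root
    unfolding lin_equiv_plane_def lin_equiv_field_def f qQ plane_def line_def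
      reals_def subfield_of_order_def[of q]
    by blast
qed

end
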